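(* Let $a<b$ be real numbers, $\alpha\in[0,1)$, $\beta>0$, $p>0$, let $\omega\in C^{1}([a,b])$ with $\omega>0$ on $[a,b]$, and let $g\in H^{1}(a,b)$. Then the power fractional derivative of $g$ can be expressed as $$ {}^{pC}D_{a,t,\omega}^{\alpha,\beta,p}g(t)=\frac{1}{\phi(\alpha)}\sum_{n=0}^{+\infty}\left(-\mu_{\alpha}\ln p\right)^{n}\;{}^{RL}I_{a,\omega}^{\beta n+1}\left(\frac{(\omega g)'}{\omega}\right)(t), $$ where the series converges locally and uniformly in $t$.
   Context: $H^1(a,b)$ is the Sobolev space of order one. Let $N$ be a positive normalization function on $[0,1)$ with $N(0)=1$ and $\lim_{\alpha\to1^-}N(\alpha)=1$; put $\phi(\alpha)=\frac{1-\alpha}{N(\alpha)}$ and $\mu_\alpha=\frac{\alpha}{1-\alpha}$. The power Mittag--Leffler function is ${}^{p}E_{k,l}(s)=\sum_{n=0}^{\infty}\frac{(s\ln p)^n}{\Gamma(kn+l)}$ for $s\in\mathbb{C}$, where $k,l,p>0$. The power fractional derivative (Caputo sense) of order $\alpha$ of $g\in H^1(a,b)$ with respect to the weight $\omega$ is $${}^{pC}D_{a,t,\omega}^{\alpha,\beta,p}g(t)=\frac{1}{\phi(\alpha)}\frac{1}{\omega(t)}\int_a^t {}^{p}E_{\beta,1}\left(-\mu_\alpha(t-s)^\beta\right)(\omega g)'(s)\,\mathrm{d}s .$$ For $\gamma>0$, the weighted Riemann--Liouville fractional integral of order $\gamma$ is $${}^{RL}I_{a,\omega}^{\gamma}g(t)=\frac{1}{\Gamma(\gamma)}\frac{1}{\omega(t)}\int_a^t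 (t-s)^{\gamma-1}(\omega g)(s)\,\mathrm{d}s .$$ *)

theory Defs
  imports "HOL-Analysis.Analysis"
begin

section \<open>Function spaces on an interval\<close>

text \<open>One-sided derivatives are taken at the end points.\<close>
definition C1_on :: "real \<Rightarrow> real \<Rightarrow> (real \<Rightarrow> real) \<Rightarrow> bool" where
  "C1_on a b w \<longleftrightarrow>
     (\<exists>w'. continuous_on {a..b} w' \<and>
           (\<forall>t\<in>{a..b}. (w has_real_derivative w' t) (at t within {a..b})))"

text \<open>Members of \<open>L2\<close> and \<open>H1\<close> are representatives: no quotient by equality almost everywhere
  is formed, and values outside of the open interval are irrelevant.\<close>
definition L2 :: "real \<Rightarrow> real \<Rightarrow> (real \<Rightarrow> real) set" where
  "L2 a b = {u. u \<in> borel_measurable (lebesgue_on {a<..<b}) \<and>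
                integrable (lebesgue_on {a<..<b}) (\<lambda>x. (u x)\<^sup>2)}"

text \<open>The space \<open>C\<^sub>c\<^sup>\<infinity>(a,b)\<close>, its members being extended by zero to the real line.\<close>
definition test_functions :: "real \<Rightarrow> real \<Rightarrow> (real \<Rightarrow> real) set" where
  "test_functions a b =
     {\<psi>. (\<forall>n x. (deriv ^^ n) \<psi> differentiable (at x)) \<and>
         (\<exists>K. compact K \<and> K \<subseteq> {a<..<b} \<and> (\<forall>x. x \<notin> K \<longrightarrow> \<psi> x = 0))}"

definition has_weak_derivative ::
    "real \<Rightarrow> real \<Rightarrow> (real \<Rightarrow> real) \<Rightarrow> (real \<Rightarrow> real) \<Rightarrow> bool" where
  "has_weak_derivative a b u v \<longleftrightarrow>
     (\<forall>\<psi>\<in>test_functions a b.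
        (LINT x:{a<..<b}|lebesgue. u x * deriv \<psi> x) = - (LINT x:{a<..<b}|lebesgue. v x * \<psi> x))"

definition H1 :: "real \<Rightarrow> real \<Rightarrow> (real \<Rightarrow> real) set" where
  "H1 a b = {u \<in> L2 a b. \<exists>v\<in>L2 a b. has_weak_derivative a b u v}"

text \<open>A representative of the weak derivative of a member of \<open>H1 a b\<close>. It is unique up to
  equality almost everywhere on \<open>(a,b)\<close>; below it only occurs under integrals over
  subintervals, where the choice does not matter.\<close>
definition weak_deriv :: "real \<Rightarrow> real \<Rightarrow> (real \<Rightarrow> real) \<Rightarrow> real \<Rightarrow> real" where
  "weak_deriv a b u = (SOME v. v \<in> L2 a b \<and> has_weak_derivative a b u v)"

section \<open>Power fractional calculus\<close>

definition normalization :: "(real \<Rightarrow> real) \<Rightarrow> bool" where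
  "normalization N \<longleftrightarrow> (\<forall>\<alpha>\<in>{0..<1}. N \<alpha> > 0) \<and> N 0 = 1 \<and> (N \<longlongrightarrow> 1) (at_left 1)"

definition phi :: "(real \<Rightarrow> real) \<Rightarrow> real \<Rightarrow> real" where
  "phi N \<alpha> = (1 - \<alpha>) / N \<alpha>"

definition mu :: "real \<Rightarrow> real" where
  "mu \<alpha> = \<alpha> / (1 - \<alpha>)"

text \<open>The type of the argument is generic so that the same series serves as an entire function
  on the complex numbers and as its restriction to the reals.\<close>
definition power_mittag_leffler ::
    "real \<Rightarrow> real \<Rightarrow> real \<Rightarrow> 'a \<Rightarrow> 'a::{real_normed_field, banach}" where
  "power_mittag_leffler p k l s =
     (\<Sum>n. (s * of_real (ln p)) ^ n / of_real (Gamma (k * real n + l)))"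

text \<open>The right end point \<open>b\<close> enters only through the interval on which the weak derivative of
  \<open>\<omega> g\<close> is formed.\<close>
definition power_caputo_deriv ::
    "(real \<Rightarrow> real) \<Rightarrow> real \<Rightarrow> real \<Rightarrow> (real \<Rightarrow> real) \<Rightarrow> real \<Rightarrow> real \<Rightarrow> real \<Rightarrow>
     (real \<Rightarrow> real) \<Rightarrow> real \<Rightarrow> real" where
  "power_caputo_deriv N a b \<omega> \<alpha> \<beta> p g t =
     1 / phi N \<alpha> * (1 / \<omega> t) *
     (LINT s:{a..t}|lebesgue.
        power_mittag_leffler p \<beta> 1 (- mu \<alpha> * (t - s) powr \<beta>) * weak_deriv a b (\<lambda>r. \<omega> r * g r) s)"

definition weighted_RL_integral ::
    "real \<Rightarrow> (real \<Rightarrow> real) \<Rightarrow> real \<Rightarrow> (real \<Rightarrow> real) \<Rightarrow> real \<Rightarrow> real" where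
  "weighted_RL_integral a \<omega> \<gamma> g t =
     1 / Gamma \<gamma> * (1 / \<omega> t) *
     (LINT s:{a..t}|lebesgue. (t - s) powr (\<gamma> - 1) * (\<omega> s * g s))"

end

theory Submission
  imports Defs
begin

text \<open>Expand the Mittag-Leffler function under the integral sign. Up to the common factor
  \<open>1 / \<omega> t\<close>, its \<open>n\<close>-th term, integrated against \<open>v = (\<omega> g)'\<close>, is the \<open>n\<close>-th term of the series of
  weighted Riemann--Liouville integrals, the weight cancelling against the quotient \<open>(\<omega> g)' / \<omega>\<close>.
  Hence only two facts have to be established.

  The first is that sum and integral may be interchanged, uniformly in \<open>t\<close>. With
  \<open>c = - \<mu>\<^sub>\<alpha> ln p\<close> the \<open>n\<close>-th term of the kernel is at most
  \<open>A\<^sub>n = (\<bar>c\<bar> (b - a)\<^sup>\<beta>)\<^sup>n / \<Gamma>(\<beta> n + 1)\<close> in absolute value, whatever \<open>t\<close> is. The \<open>A\<^sub>n\<close> are summable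
  because the Gamma function grows faster than any exponential
  (\<open>summable_power_over_Gamma\<close>). As \<open>v\<close> is integrable, dominated convergence permits the
  interchange (\<open>kernel_integral_sums\<close>), and the Weierstrass test with the majorants
  \<open>A\<^sub>n \<integral>\<bar>v\<bar> max (1 / \<omega>)\<close> gives convergence that is uniform on all of \<open>[a,b]\<close>.

  The second fact is that \<open>v\<close> is integrable, for which \<open>\<omega> g\<close> needs to have a weak derivative in
  \<open>L\<^sup>2\<close>, i.e. that multiplication by a \<open>C\<^sup>1\<close> weight preserves \<open>H\<^sup>1\<close> (\<open>H1_mult_C1\<close>). If \<open>\<psi>\<close> is a test
  function, \<open>\<omega> \<psi>\<close> is merely \<open>C\<^sup>1\<close> and so cannot be inserted into the definition of the weak
  derivative of \<open>g\<close>; but \<open>Q \<psi>\<close> can, for a polynomial \<open>Q\<close>. Polynomials are dense in \<open>C\<^sup>1([a,b])\<close>, and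
  the resulting identity passes to the limit \<open>Q \<rightarrow> \<omega>\<close>.\<close>

section \<open>Growth of the Gamma function\<close>

text \<open>Restrict Euler's integral \<open>\<integral> t\<^sup>z e\<^sup>-\<^sup>t dt\<close> to \<open>[R, R + 1]\<close> and bound both factors of the
  integrand there. The point of the estimate is that \<open>R\<close> is arbitrary and the constant does
  not depend on \<open>z\<close>.\<close>
lemma Gamma_ge_powr:
  fixes z R :: real
  assumes "z \<ge> 0" "R > 0"
  shows "R powr z * exp (- (R + 1)) \<le> Gamma (z + 1)"
proof -
  have 1: "((\<lambda>t. t powr z / exp t) has_integral Gamma (z + 1)) {0..}"
    using Gamma_integral_real[of "z + 1"] assms by simp
  have 2: "((\<lambda>t. t powr z / exp t) has_integral (integral {R..R+1} (\<lambda>t. t powr z / exp t))) {R..R+1}"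
    using assms by (intro integrable_integral integrable_continuous_real continuous_intros) auto
  have 3: "((\<lambda>t. R powr z * exp (- (R + 1))) has_integral (R powr z * exp (- (R + 1)))) {R..R+1}"
    using has_integral_const_real[of "R powr z * exp (- (R + 1))" R "R + 1"] by simp
  have "R powr z * exp (- (R + 1)) \<le> integral {R..R+1} (\<lambda>t. t powr z / exp t)"
  proof (rule has_integral_le[OF 3 2])
    fix t assume "t \<in> {R..R+1}"
    then show "R powr z * exp (- (R + 1)) \<le> t powr z / exp t"
      unfolding divide_inverse exp_minus[symmetric]
      using assms by (intro mult_mono powr_mono2) auto
  qed
  also have "\<dots> \<le> Gamma (z + 1)"
    using assms by (intro has_integral_subset_le[OF _ 2 1]) auto
  finally show ?thesis .
qed

lemma Gamma_mult_nat_add_1_pos: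
  fixes \<beta> :: real
  shows "\<beta> > 0 \<Longrightarrow> Gamma (\<beta> * real n + 1) > 0"
  by (intro Gamma_real_pos add_nonneg_pos) auto

text \<open>Choosing \<open>R\<close> in the preceding bound with \<open>R\<^sup>\<beta> > 2 \<bar>x\<bar>\<close> makes a geometric series of ratio
  \<open>1 / 2\<close> a majorant.\<close>
lemma summable_power_over_Gamma:
  fixes x \<beta> :: real
  assumes "\<beta> > 0"
  shows "summable (\<lambda>n. x ^ n / Gamma (\<beta> * real n + 1))"
proof (rule summable_comparison_test)
  \<comment> \<open>Adding \<open>1\<close> keeps \<open>y\<close> positive when \<open>x = 0\<close>.\<close>
  define y where "y = 2 * (\<bar>x\<bar> + 1)"
  define R where "R = y powr (1 / \<beta>)"
  have y: "y > 0" and R: "R > 0" and Ry: "R powr \<beta> = y"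
    using assms by (auto simp: y_def R_def powr_powr)
  have bound: "norm (x ^ n / Gamma (\<beta> * real n + 1)) \<le> exp (R + 1) * (1 / 2) ^ n" for n
  proof -
    have "y ^ n * exp (- (R + 1)) \<le> Gamma (\<beta> * real n + 1)"
      using Gamma_ge_powr[of "\<beta> * real n" R] assms R y Ry
      by (simp add: powr_powr[symmetric] powr_realpow)
    then have "norm (x ^ n / Gamma (\<beta> * real n + 1)) \<le> \<bar>x\<bar> ^ n / (y ^ n * exp (- (R + 1)))"
      using y Gamma_mult_nat_add_1_pos[OF assms, of n]
      by (auto simp: power_abs intro!: divide_left_mono mult_pos_pos)
    also have "\<dots> = exp (R + 1) * (\<bar>x\<bar> / y) ^ n"
      unfolding exp_minus by (simp add: power_divide field_simps)
    also have "\<dots> \<le> exp (R + 1) * (1 / 2) ^ n"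
      by (intro mult_left_mono power_mono) (auto simp: y_def field_simps)
    finally show ?thesis .
  qed
  then show "\<exists>N. \<forall>n\<ge>N. norm (x ^ n / Gamma (\<beta> * real n + 1)) \<le> exp (R + 1) * (1 / 2) ^ n"
    by blast
  show "summable (\<lambda>n. exp (R + 1) * (1 / 2 :: real) ^ n)"
    by (intro summable_mult summable_geometric) auto
qed

section \<open>Integrable functions on a bounded interval\<close>

lemma continuous_on_Icc_measurable_Ioo:
  fixes c :: "real \<Rightarrow> real"
  assumes "continuous_on {a..b} c"
  shows "c \<in> borel_measurable (lebesgue_on {a<..<b})"
  by (rule continuous_imp_measurable_on_sets_lebesgue)
     (auto intro: continuous_on_subset[OF assms])

lemma continuous_on_Icc_bounded:
  fixes c :: "real \<Rightarrow> real"
  assumes "continuous_on {a..b} c"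
  obtains B where "B \<ge> 0" "\<And>x. x \<in> {a..b} \<Longrightarrow> \<bar>c x\<bar> \<le> B"
proof -
  have "bounded (c ` {a..b})"
    by (intro compact_imp_bounded compact_continuous_image assms) auto
  then obtain B where "B > 0" "\<And>x. x \<in> {a..b} \<Longrightarrow> \<bar>c x\<bar> \<le> B"
    unfolding bounded_pos by auto
  then show ?thesis using that[of B] by auto
qed

lemma integrable_continuous_mult:
  fixes c f :: "real \<Rightarrow> real"
  assumes c: "continuous_on {a..b} c" and f: "integrable (lebesgue_on {a<..<b}) f"
  shows "integrable (lebesgue_on {a<..<b}) (\<lambda>x. c x * f x)"
proof -
  obtain B where B: "B \<ge> 0" "\<And>x. x \<in> {a..b} \<Longrightarrow> \<bar>c x\<bar> \<le> B"
    using continuous_on_Icc_bounded[OF c] by metis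
  show ?thesis
  proof (rule Bochner_Integration.integrable_bound)
    show "integrable (lebesgue_on {a<..<b}) (\<lambda>x. B * f x)" using f by simp
    show "(\<lambda>x. c x * f x) \<in> borel_measurable (lebesgue_on {a<..<b})"
      by (intro borel_measurable_times continuous_on_Icc_measurable_Ioo c
          borel_measurable_integrable f)
    show "AE x in lebesgue_on {a<..<b}. norm (c x * f x) \<le> norm (B * f x)"
      using B by (auto intro!: AE_I2 mult_right_mono simp: abs_mult)
  qed
qed

text \<open>Leaving out the end points changes no integral, and it makes \<open>t - s\<close> positive throughout
  the domain of integration. This matters because \<open>0 powr 0 = 0\<close>: at \<open>s = t\<close> the term of index \<open>0\<close>
  of the Riemann--Liouville series is not that of the Mittag-Leffler series.\<close>
lemma set_integral_Icc_eq_Ioo: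
  fixes f :: "real \<Rightarrow> real"
  shows "(LINT x:{a..b}|lebesgue. f x) = integral\<^sup>L (lebesgue_on {a<..<b}) f"
proof -
  have "(LINT x:{a..b}|lebesgue. f x) = (LINT x:{a<..<b}|lebesgue. f x)"
    by (rule set_integral_discrete_difference[where X = "{a, b}"]) auto
  then show ?thesis
    by (simp add: integral_restrict_space set_lebesgue_integral_def)
qed

lemma integrable_lebesgue_on_Ioo_mono:
  fixes f :: "real \<Rightarrow> real"
  assumes "integrable (lebesgue_on {a<..<b}) f" "t \<le> b"
  shows "integrable (lebesgue_on {a<..<t}) f"
proof -
  have "set_integrable lebesgue {a<..<b} f"
    using assms by (simp add: integrable_restrict_space set_integrable_def)
  then have "set_integrable lebesgue {a<..<t} f"
    by (rule set_integrable_subset) (use assms in auto)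
  then show ?thesis
    by (simp add: integrable_restrict_space set_integrable_def)
qed

lemma integral_abs_lebesgue_on_Ioo_mono:
  fixes f :: "real \<Rightarrow> real"
  assumes f: "integrable (lebesgue_on {a<..<b}) f" and t: "t \<le> b"
  shows "integral\<^sup>L (lebesgue_on {a<..<t}) (\<lambda>x. \<bar>f x\<bar>) \<le>
    integral\<^sup>L (lebesgue_on {a<..<b}) (\<lambda>x. \<bar>f x\<bar>)"
proof -
  have 1: "integrable lebesgue (\<lambda>x. indicator {a<..<s} x *\<^sub>R \<bar>f x\<bar>)" if "s \<le> b" for s
    using integrable_abs[OF integrable_lebesgue_on_Ioo_mono[OF f that]]
    by (simp add: integrable_restrict_space)
  have "integral\<^sup>L lebesgue (\<lambda>x. indicator {a<..<t} x *\<^sub>R \<bar>f x\<bar>) \<le>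
      integral\<^sup>L lebesgue (\<lambda>x. indicator {a<..<b} x *\<^sub>R \<bar>f x\<bar>)"
    using t by (intro integral_mono 1) (auto simp: indicator_def)
  then show ?thesis by (simp add: integral_restrict_space)
qed

lemma L2_imp_integrable:
  assumes "u \<in> L2 a b"
  shows "integrable (lebesgue_on {a<..<b}) u"
proof (rule Bochner_Integration.integrable_bound)
  interpret finite_measure "lebesgue_on {a<..<b}"
    by (rule finite_measure_lebesgue_on) simp
  show "integrable (lebesgue_on {a<..<b}) (\<lambda>x. 1 + (u x)\<^sup>2)"
    using assms by (auto simp: L2_def)
  show "u \<in> borel_measurable (lebesgue_on {a<..<b})"
    using assms by (auto simp: L2_def)
  have "\<bar>y\<bar> \<le> 1 + y\<^sup>2" for y :: real
    using zero_le_power2[of "\<bar>y\<bar> - 1"] by (auto simp: power2_eq_square algebra_simps)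
  then show "AE x in lebesgue_on {a<..<b}. norm (u x) \<le> norm (1 + (u x)\<^sup>2)"
    by auto
qed

lemma L2_continuous_mult:
  assumes c: "continuous_on {a..b} c" and u: "u \<in> L2 a b"
  shows "(\<lambda>x. c x * u x) \<in> L2 a b"
proof -
  have "integrable (lebesgue_on {a<..<b}) (\<lambda>x. (c x)\<^sup>2 * (u x)\<^sup>2)"
    using u by (intro integrable_continuous_mult continuous_intros c) (auto simp: L2_def)
  then show ?thesis
    using u continuous_on_Icc_measurable_Ioo[OF c] by (auto simp: L2_def power_mult_distrib)
qed

lemma L2_add:
  assumes u: "u \<in> L2 a b" and v: "v \<in> L2 a b"
  shows "(\<lambda>x. u x + v x) \<in> L2 a b"
proof -
  have "integrable (lebesgue_on {a<..<b}) (\<lambda>x. (u x + v x)\<^sup>2)"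
  proof (rule Bochner_Integration.integrable_bound)
    show "integrable (lebesgue_on {a<..<b}) (\<lambda>x. 2 * (u x)\<^sup>2 + 2 * (v x)\<^sup>2)"
      using u v by (auto simp: L2_def)
    show "(\<lambda>x. (u x + v x)\<^sup>2) \<in> borel_measurable (lebesgue_on {a<..<b})"
      using u v by (auto simp: L2_def)
    have "(y + z)\<^sup>2 \<le> 2 * y\<^sup>2 + 2 * z\<^sup>2" for y z :: real
      using zero_le_power2[of "y - z"] by (auto simp: power2_eq_square algebra_simps)
    then show "AE x in lebesgue_on {a<..<b}. norm ((u x + v x)\<^sup>2) \<le> norm (2 * (u x)\<^sup>2 + 2 * (v x)\<^sup>2)"
      by auto
  qed
  then show ?thesis
    using u v by (auto simp: L2_def)
qed

section \<open>Test functions\<close>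

text \<open>The derivatives are truncated at order \<open>n\<close> so that closure under products can be proved by
  induction: \<open>(f g)' = f' g + g' f\<close> reduces the order, whereas a direct treatment of
  \<open>(deriv ^^ n) (f g)\<close> would require the Leibniz formula.\<close>
definition differentiable_upto :: "nat \<Rightarrow> (real \<Rightarrow> real) \<Rightarrow> bool" where
  "differentiable_upto n f \<longleftrightarrow> (\<forall>k\<le>n. \<forall>x. (deriv ^^ k) f differentiable (at x))"

lemma differentiable_upto_0:
  "differentiable_upto 0 f \<longleftrightarrow> (\<forall>x. f differentiable (at x))"
  by (simp add: differentiable_upto_def)

lemma differentiable_upto_Suc:
  "differentiable_upto (Suc n) f \<longleftrightarrow>
     (\<forall>x. f differentiable (at x)) \<and> differentiable_upto n (deriv f)"
proof -
  have "(\<forall>k\<le>Suc n. P k) \<longleftrightarrow> P 0 \<and> (\<forall>k\<le>n. P (Suc k))" for P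
    by (metis Suc_le_mono le0 not0_implies_Suc)
  then show ?thesis
    by (simp add: differentiable_upto_def funpow_swap1)
qed

lemma differentiable_upto_SucD: "differentiable_upto (Suc n) f \<Longrightarrow> differentiable_upto n f"
  by (simp add: differentiable_upto_def)

lemma differentiable_upto_const: "differentiable_upto n (\<lambda>x. c)"
  by (induction n arbitrary: c) (auto simp: differentiable_upto_0 differentiable_upto_Suc)

lemma differentiable_upto_add:
  "differentiable_upto n f \<Longrightarrow> differentiable_upto n g \<Longrightarrow> differentiable_upto n (\<lambda>x. f x + g x)"
proof (induction n arbitrary: f g)
  case (Suc n)
  then have "deriv (\<lambda>x. f x + g x) = (\<lambda>x. deriv f x + deriv g x)"
    by (auto simp: differentiable_upto_Suc DERIV_deriv_iff_real_differentiable[symmetric]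
        intro!: ext DERIV_imp_deriv derivative_intros)
  with Suc show ?case by (auto simp: differentiable_upto_Suc)
qed (auto simp: differentiable_upto_0)

lemma differentiable_upto_mult:
  "differentiable_upto n f \<Longrightarrow> differentiable_upto n g \<Longrightarrow> differentiable_upto n (\<lambda>x. f x * g x)"
proof (induction n arbitrary: f g)
  case (Suc n)
  then have "deriv (\<lambda>x. f x * g x) = (\<lambda>x. deriv f x * g x + deriv g x * f x)"
    by (auto simp: differentiable_upto_Suc DERIV_deriv_iff_real_differentiable[symmetric]
        intro!: ext DERIV_imp_deriv DERIV_mult)
  moreover have "differentiable_upto n (\<lambda>x. deriv f x * g x + deriv g x * f x)"
    using Suc by (intro differentiable_upto_add Suc.IH)
      (auto simp: differentiable_upto_Suc intro: differentiable_upto_SucD[of _ f] differentiable_upto_SucD[of _ g])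
  ultimately show ?case using Suc.prems by (auto simp: differentiable_upto_Suc)
qed (auto simp: differentiable_upto_0)

lemma differentiable_upto_real_polynomial:
  fixes q :: "real \<Rightarrow> real"
  shows "real_polynomial_function q \<Longrightarrow> differentiable_upto n q"
proof (induction q rule: real_polynomial_function.induct)
  case (linear f)
  obtain c where f: "f = (\<lambda>x. x * c)"
    using real_bounded_linear linear by metis
  have "differentiable_upto n (\<lambda>x. x :: real)"
    by (cases n) (auto simp: differentiable_upto_0 differentiable_upto_Suc differentiable_upto_const)
  then show ?case
    unfolding f by (intro differentiable_upto_mult differentiable_upto_const)
qed (auto intro: differentiable_upto_const differentiable_upto_add differentiable_upto_mult)

text \<open>This is why polynomials are the right approximants of a \<open>C\<^sup>1\<close> weight: they may be absorbed
  into the test function.\<close>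
lemma test_functions_polynomial_mult:
  assumes "\<psi> \<in> test_functions a b" and q: "real_polynomial_function q"
  shows "(\<lambda>x. q x * \<psi> x) \<in> test_functions a b"
proof -
  obtain K where smooth: "\<And>n. differentiable_upto n \<psi>"
    and K: "compact K" "K \<subseteq> {a<..<b}" "\<And>x. x \<notin> K \<Longrightarrow> \<psi> x = 0"
    using assms(1) unfolding test_functions_def differentiable_upto_def by blast
  have "differentiable_upto n (\<lambda>x. q x * \<psi> x)" for n
    by (rule differentiable_upto_mult[OF differentiable_upto_real_polynomial[OF q] smooth])
  then have "\<forall>n x. (deriv ^^ n) (\<lambda>x. q x * \<psi> x) differentiable (at x)"
    unfolding differentiable_upto_def by blast
  moreover have "\<exists>K. compact K \<and> K \<subseteq> {a<..<b} \<and> (\<forall>x. x \<notin> K \<longrightarrow> q x * \<psi> x = 0)"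
    using K by (intro exI[of _ K]) simp
  ultimately show ?thesis
    unfolding test_functions_def by blast
qed

lemma test_functions_DERIV:
  assumes "\<psi> \<in> test_functions a b"
  shows "(\<psi> has_real_derivative deriv \<psi> x) (at x)"
  using assms unfolding test_functions_def DERIV_deriv_iff_real_differentiable
  by (auto dest: spec[of _ "0 :: nat"])

lemma test_functions_continuous_deriv:
  assumes "\<psi> \<in> test_functions a b"
  shows "continuous_on S (deriv \<psi>)"
proof -
  have "\<forall>x. (deriv ^^ 1) \<psi> differentiable (at x)"
    using assms unfolding test_functions_def by blast
  then show ?thesis
    by (auto intro!: continuous_at_imp_continuous_on differentiable_imp_continuous_within)
qed

lemma test_functions_continuous:
  assumes "\<psi> \<in> test_functions a b"
  shows "continuous_on S \<psi>"
  using test_functions_DERIV[OF assms] by (meson DERIV_continuous_on has_field_derivative_at_within)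

section \<open>The product rule for weak derivatives\<close>

lemma real_polynomial_antiderivative:
  fixes q :: "real \<Rightarrow> real"
  assumes "real_polynomial_function q"
  obtains Q where "real_polynomial_function Q" "Q x0 = y0"
    "\<And>x. (Q has_real_derivative q x) (at x)"
proof -
  obtain c n where q: "q = (\<lambda>x. \<Sum>i\<le>n. c i * x ^ i)"
    using assms real_polynomial_function_iff_sum by metis
  define P where "P = (\<lambda>x. \<Sum>i\<le>n. c i / real (Suc i) * x ^ Suc i)"
  have "real_polynomial_function P"
    unfolding P_def
    by (intro real_polynomial_function_sum real_polynomial_function.intros(2,4)
        real_polynomial_function_power real_polynomial_function.intros(1) bounded_linear_ident) auto
  then have "real_polynomial_function (\<lambda>x. P x + (y0 - P x0))"
    by (intro real_polynomial_function.intros(2,3))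
  moreover have "(P has_real_derivative q x) (at x)" for x
    unfolding P_def q
  proof (rule DERIV_sum)
    fix i
    show "((\<lambda>x. c i / real (Suc i) * x ^ Suc i) has_real_derivative c i * x ^ i) (at x)"
      using DERIV_cmult[OF DERIV_pow[of "Suc i" x], of "c i / real (Suc i)"]
      by (simp del: of_nat_Suc power_Suc)
  qed
  then have "((\<lambda>x. P x + (y0 - P x0)) has_real_derivative q x) (at x)" for x
    by (auto intro!: derivative_eq_intros)
  ultimately show ?thesis using that by auto
qed

text \<open>Approximate \<open>w'\<close>, not \<open>w\<close>, by Weierstrass' theorem and integrate the polynomial; the mean
  value inequality then controls the function itself. Approximating \<open>w\<close> directly would say
  nothing about the derivatives.\<close>
lemma C1_on_polynomial_approx:
  assumes ab: "a < b" and w': "continuous_on {a..b} w'"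
    and der: "\<And>t. t \<in> {a..b} \<Longrightarrow> (w has_real_derivative w' t) (at t within {a..b})"
    and "\<epsilon> > 0"
  obtains Q q where "real_polynomial_function Q" "real_polynomial_function q"
    "\<And>x. (Q has_real_derivative q x) (at x)"
    "\<And>x. x \<in> {a..b} \<Longrightarrow> \<bar>Q x - w x\<bar> \<le> \<epsilon> * (b - a)"
    "\<And>x. x \<in> {a..b} \<Longrightarrow> \<bar>q x - w' x\<bar> \<le> \<epsilon>"
proof -
  obtain q where q: "real_polynomial_function q" "\<And>x. x \<in> {a..b} \<Longrightarrow> \<bar>w' x - q x\<bar> < \<epsilon>"
    using Stone_Weierstrass_real_polynomial_function[OF compact_Icc w' \<open>\<epsilon> > 0\<close>] by metis
  obtain Q where Q: "real_polynomial_function Q" "Q a = w a"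
    "\<And>x. (Q has_real_derivative q x) (at x)"
    using real_polynomial_antiderivative[OF q(1)] by metis
  have *: "\<bar>Q x - w x\<bar> \<le> \<epsilon> * (b - a)" if x: "x \<in> {a..b}" for x
  proof -
    have "norm ((Q x - w x) - (Q a - w a)) \<le> \<epsilon> * norm (x - a)"
    proof (rule field_differentiable_bound[of "{a..b}" _ "\<lambda>x. q x - w' x"])
      show "((\<lambda>x. Q x - w x) has_field_derivative q z - w' z) (at z within {a..b})"
        if "z \<in> {a..b}" for z
        by (intro DERIV_diff has_field_derivative_at_within[OF Q(3)] der[OF that])
      show "norm (q z - w' z) \<le> \<epsilon>" if "z \<in> {a..b}" for z
        using q(2)[OF that] by (simp add: abs_minus_commute)
    qed (use x ab in auto)
    also have "\<dots> \<le> \<epsilon> * (b - a)"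
      using x \<open>\<epsilon> > 0\<close> by (intro mult_left_mono) auto
    finally show ?thesis using Q by simp
  qed
  have "\<bar>q x - w' x\<bar> \<le> \<epsilon>" if "x \<in> {a..b}" for x
    using q(2)[OF that] by (simp add: abs_minus_commute)
  with * show ?thesis
    using that[OF Q(1) q(1) Q(3)] by blast
qed

text \<open>Restricting the measure in place of the integrand makes the theorems on Bochner integrals
  applicable as they stand.\<close>
lemma has_weak_derivative_iff:
  "has_weak_derivative a b u v \<longleftrightarrow>
     (\<forall>\<psi>\<in>test_functions a b.
        integral\<^sup>L (lebesgue_on {a<..<b}) (\<lambda>x. u x * deriv \<psi> x) =
        - integral\<^sup>L (lebesgue_on {a<..<b}) (\<lambda>x. v x * \<psi> x))"
  unfolding has_weak_derivative_def
  by (simp add: integral_restrict_space set_lebesgue_integral_def)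

text \<open>The identity to be shown is \<open>\<integral> (w \<psi>)' u + (w \<psi>) v = 0\<close>. It holds with a polynomial in
  place of \<open>w\<close>, by the definition of the weak derivative of \<open>u\<close>, and the integral depends continuously on \<open>w\<close>
  for the \<open>C\<^sup>1\<close> norm.\<close>
lemma has_weak_derivative_mult_C1:
  assumes ab: "a < b" and w': "continuous_on {a..b} w'"
    and der: "\<And>t. t \<in> {a..b} \<Longrightarrow> (w has_real_derivative w' t) (at t within {a..b})"
    and uv: "has_weak_derivative a b u v"
    and u: "integrable (lebesgue_on {a<..<b}) u"
    and v: "integrable (lebesgue_on {a<..<b}) v"
  shows "has_weak_derivative a b (\<lambda>x. w x * u x) (\<lambda>x. w' x * u x + w x * v x)"
  unfolding has_weak_derivative_iff
proof
  let ?M = "lebesgue_on {a<..<b}"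
  fix \<psi> assume \<psi>: "\<psi> \<in> test_functions a b"
  have w: "continuous_on {a..b} w"
    by (rule DERIV_continuous_on[OF der])
  note cont = test_functions_continuous[OF \<psi>] test_functions_continuous_deriv[OF \<psi>]
  define F where "F = (\<lambda>P p x. (P x * deriv \<psi> x + p x * \<psi> x) * u x + (P x * \<psi> x) * v x)"
  have F_int: "integrable ?M (F P p)"
    if "continuous_on {a..b} P" "continuous_on {a..b} p" for P p
    unfolding F_def
    by (intro Bochner_Integration.integrable_add integrable_continuous_mult continuous_intros
        cont that u v)
  \<comment> \<open>\<open>F P P'\<close> is \<open>(P \<psi>)' u + (P \<psi>) v\<close>, so its integral vanishes if \<open>P \<psi>\<close> is a test function.\<close>
  have F_poly: "integral\<^sup>L ?M (F Q q) = 0"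
    if Q: "real_polynomial_function Q" and q: "real_polynomial_function q"
      and QD: "\<And>x. (Q has_real_derivative q x) (at x)" for Q q
  proof -
    have Qc: "continuous_on {a..b} Q" "continuous_on {a..b} q"
      using Q q by (auto simp: continuous_on_polymonial_function real_polynomial_function_eq)
    have "deriv (\<lambda>x. Q x * \<psi> x) = (\<lambda>x. Q x * deriv \<psi> x + q x * \<psi> x)"
      using DERIV_mult[OF QD test_functions_DERIV[OF \<psi>]]
      by (intro ext DERIV_imp_deriv) (simp add: ac_simps)
    then have *: "integral\<^sup>L ?M (\<lambda>x. (Q x * deriv \<psi> x + q x * \<psi> x) * u x) =
        - integral\<^sup>L ?M (\<lambda>x. (Q x * \<psi> x) * v x)"
      using uv test_functions_polynomial_mult[OF \<psi> Q]
      unfolding has_weak_derivative_iff by (auto simp: mult.commute)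
    show ?thesis
      unfolding F_def
      by (subst Bochner_Integration.integral_add)
        (auto simp: * intro!: integrable_continuous_mult continuous_intros cont Qc u v)
  qed
  have "\<exists>Q q. real_polynomial_function Q \<and> real_polynomial_function q \<and>
      (\<forall>x. (Q has_real_derivative q x) (at x)) \<and>
      (\<forall>x\<in>{a..b}. \<bar>Q x - w x\<bar> \<le> 1 / real (Suc n) * (b - a)) \<and>
      (\<forall>x\<in>{a..b}. \<bar>q x - w' x\<bar> \<le> 1 / real (Suc n))" for n
    using C1_on_polynomial_approx[OF ab w' der, of "1 / real (Suc n)"] by (metis zero_less_divide_1_iff of_nat_0_less_iff zero_less_Suc)
  then obtain Q q where Qq: "\<And>n. real_polynomial_function (Q n)" "\<And>n. real_polynomial_function (q n)"
      "\<And>n x. (Q n has_real_derivative q n x) (at x)"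
      and Qw: "\<And>n x. x \<in> {a..b} \<Longrightarrow> \<bar>Q n x - w x\<bar> \<le> 1 / real (Suc n) * (b - a)"
      and qw: "\<And>n x. x \<in> {a..b} \<Longrightarrow> \<bar>q n x - w' x\<bar> \<le> 1 / real (Suc n)"
    by metis
  have lim0: "(\<lambda>n. 1 / real (Suc n)) \<longlonglongrightarrow> 0"
    using LIMSEQ_inverse_real_of_nat by (simp add: inverse_eq_divide)
  have Qlim: "(\<lambda>n. Q n x) \<longlonglongrightarrow> w x" if "x \<in> {a..b}" for x
  proof -
    have "(\<lambda>n. Q n x - w x) \<longlonglongrightarrow> 0"
      using tendsto_mult_left_zero[OF lim0, of "b - a"] Qw[OF that]
      by (intro Lim_null_comparison[of "\<lambda>n. Q n x - w x" "\<lambda>n. 1 / real (Suc n) * (b - a)"]) auto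
    then show ?thesis by (simp add: LIM_zero_iff)
  qed
  have qlim: "(\<lambda>n. q n x) \<longlonglongrightarrow> w' x" if "x \<in> {a..b}" for x
  proof -
    have "(\<lambda>n. q n x - w' x) \<longlonglongrightarrow> 0"
      using lim0 qw[OF that]
      by (intro Lim_null_comparison[of "\<lambda>n. q n x - w' x" "\<lambda>n. 1 / real (Suc n)"]) auto
    then show ?thesis by (simp add: LIM_zero_iff)
  qed
  \<comment> \<open>All approximations are within \<open>b - a\<close> of \<open>w\<close>, their derivatives within \<open>1\<close> of \<open>w'\<close>; this
    yields an integrable majorant common to all \<open>n\<close>.\<close>
  obtain A where A: "A \<ge> 0" "\<And>x. x \<in> {a..b} \<Longrightarrow> \<bar>w x\<bar> \<le> A"
    using continuous_on_Icc_bounded[OF w] by metis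
  obtain B where B: "B \<ge> 0" "\<And>x. x \<in> {a..b} \<Longrightarrow> \<bar>w' x\<bar> \<le> B"
    using continuous_on_Icc_bounded[OF w'] by metis
  have QA: "\<bar>Q n x\<bar> \<le> A + (b - a)" and qB: "\<bar>q n x\<bar> \<le> B + 1" if "x \<in> {a..b}" for n x
  proof -
    have "1 / real (Suc n) * (b - a) \<le> 1 * (b - a)"
      using ab by (intro mult_right_mono) auto
    with Qw[OF that, of n] have "\<bar>Q n x - w x\<bar> \<le> b - a"
      by simp
    then show "\<bar>Q n x\<bar> \<le> A + (b - a)"
      using A(2)[OF that] by linarith
    have "1 / real (Suc n) \<le> 1" by simp
    with qw[OF that, of n] have "\<bar>q n x - w' x\<bar> \<le> 1"
      by linarith
    then show "\<bar>q n x\<bar> \<le> B + 1"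
      using B(2)[OF that] by linarith
  qed
  have polc: "continuous_on {a..b} (Q n)" "continuous_on {a..b} (q n)" for n
    using Qq by (auto simp: continuous_on_polymonial_function real_polynomial_function_eq)
  let ?D = "\<lambda>x. ((A + (b - a)) * \<bar>deriv \<psi> x\<bar> + (B + 1) * \<bar>\<psi> x\<bar>) * \<bar>u x\<bar> +
      ((A + (b - a)) * \<bar>\<psi> x\<bar>) * \<bar>v x\<bar>"
  have "(\<lambda>n. integral\<^sup>L ?M (F (Q n) (q n))) \<longlonglongrightarrow> integral\<^sup>L ?M (F w w')"
  proof (rule integral_dominated_convergence[where w = ?D])
    show "integrable ?M ?D"
      by (intro Bochner_Integration.integrable_add integrable_continuous_mult continuous_intros
          cont integrable_abs u v)
    show "F w w' \<in> borel_measurable ?M" "\<And>n. F (Q n) (q n) \<in> borel_measurable ?M"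
      by (intro borel_measurable_integrable F_int w w' polc)+
    show "AE x in ?M. (\<lambda>n. F (Q n) (q n) x) \<longlonglongrightarrow> F w w' x"
      unfolding F_def by (intro AE_I2 tendsto_intros Qlim qlim) auto
    show "AE x in ?M. norm (F (Q n) (q n) x) \<le> ?D x" for n
    proof (rule AE_I2)
      fix x assume "x \<in> space ?M"
      then have x: "x \<in> {a..b}" by auto
      have "norm (F (Q n) (q n) x) \<le> (\<bar>Q n x\<bar> * \<bar>deriv \<psi> x\<bar> + \<bar>q n x\<bar> * \<bar>\<psi> x\<bar>) * \<bar>u x\<bar> +
          (\<bar>Q n x\<bar> * \<bar>\<psi> x\<bar>) * \<bar>v x\<bar>"
        unfolding F_def real_norm_def abs_mult[symmetric]
        by (rule order_trans[OF abs_triangle_ineq])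
           (auto simp: abs_mult intro!: mult_right_mono order_trans[OF abs_triangle_ineq])
      also have "\<dots> \<le> ?D x"
        using ab A(1) B(1)
        by (intro add_mono mult_mono QA[OF x] qB[OF x]) auto
      finally show "norm (F (Q n) (q n) x) \<le> ?D x" .
    qed
  qed
  then have "integral\<^sup>L ?M (F w w') = 0"
    by (simp add: F_poly[OF Qq] LIMSEQ_const_iff)
  moreover have "F w w' = (\<lambda>x. w x * u x * deriv \<psi> x + (w' x * u x + w x * v x) * \<psi> x)"
    by (auto simp: F_def algebra_simps)
  moreover have "integrable ?M (\<lambda>x. w x * u x * deriv \<psi> x)"
    using integrable_continuous_mult[OF continuous_on_mult[OF w cont(2)] u]
    by (simp add: ac_simps)
  moreover have "integrable ?M (\<lambda>x. (w' x * u x + w x * v x) * \<psi> x)"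
    using integrable_continuous_mult[OF cont(1) Bochner_Integration.integrable_add[OF
        integrable_continuous_mult[OF w' u] integrable_continuous_mult[OF w v]]]
    by (simp add: ac_simps)
  ultimately show "integral\<^sup>L ?M (\<lambda>x. w x * u x * deriv \<psi> x) =
      - integral\<^sup>L ?M (\<lambda>x. (w' x * u x + w x * v x) * \<psi> x)"
    by simp
qed

lemma H1_mult_C1:
  assumes ab: "a < b" and w: "C1_on a b w" and u: "u \<in> H1 a b"
  shows "(\<lambda>x. w x * u x) \<in> H1 a b"
proof -
  obtain w' where w': "continuous_on {a..b} w'"
    and der: "\<And>t. t \<in> {a..b} \<Longrightarrow> (w has_real_derivative w' t) (at t within {a..b})"
    using w by (auto simp: C1_on_def)
  obtain v where u2: "u \<in> L2 a b" and v2: "v \<in> L2 a b" and uv: "has_weak_derivative a b u v"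
    using u by (auto simp: H1_def)
  have "continuous_on {a..b} w"
    by (rule DERIV_continuous_on[OF der])
  with u2 v2 w' have "(\<lambda>x. w x * u x) \<in> L2 a b" "(\<lambda>x. w' x * u x + w x * v x) \<in> L2 a b"
    by (auto intro!: L2_add L2_continuous_mult)
  then show ?thesis
    using has_weak_derivative_mult_C1[OF ab w' der uv L2_imp_integrable[OF u2] L2_imp_integrable[OF v2]]
    by (auto simp: H1_def)
qed

text \<open>The defining choice of \<open>weak_deriv\<close> says something only if a weak derivative exists, hence
  the hypothesis.\<close>
lemma weak_deriv_L2:
  assumes "u \<in> H1 a b"
  shows "weak_deriv a b u \<in> L2 a b"
  using assms someI_ex[of "\<lambda>v. v \<in> L2 a b \<and> has_weak_derivative a b u v"]
  by (auto simp: H1_def weak_deriv_def)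

section \<open>Termwise integration of the Mittag-Leffler kernel\<close>

lemma kernel_term_bound:
  fixes c :: real
  assumes "\<beta> > 0" "0 \<le> r" "r \<le> L"
  shows "\<bar>c ^ n * r powr (\<beta> * real n) / Gamma (\<beta> * real n + 1)\<bar> \<le>
    (\<bar>c\<bar> * L powr \<beta>) ^ n / Gamma (\<beta> * real n + 1)"
proof (cases "r = 0")
  case True
  then show ?thesis using assms Gamma_mult_nat_add_1_pos[of \<beta> n]
    by (auto intro!: divide_nonneg_pos)
next
  case False
  have "\<bar>c\<bar> ^ n * r powr (\<beta> * real n) \<le> \<bar>c\<bar> ^ n * L powr (\<beta> * real n)"
    using assms by (intro mult_left_mono powr_mono2) auto
  also have "\<dots> = (\<bar>c\<bar> * L powr \<beta>) ^ n"
    using assms False by (simp add: power_mult_distrib powr_powr[symmetric] powr_realpow)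
  finally show ?thesis
    using assms Gamma_mult_nat_add_1_pos[of \<beta> n]
    by (auto simp: abs_mult power_abs intro!: divide_right_mono)
qed

text \<open>Both statements rest on the same majorant of the kernel. The length \<open>L\<close> is kept apart from
  \<open>t - a\<close> so that the bound can be made independent of \<open>t\<close>, as uniform convergence requires.\<close>
lemma
  fixes c :: real
  assumes \<beta>: "\<beta> > 0" and L: "t - a \<le> L" and v: "integrable (lebesgue_on {a<..<t}) v"
  defines "I \<equiv> \<lambda>n. integral\<^sup>L (lebesgue_on {a<..<t})
    (\<lambda>s. c ^ n * (t - s) powr (\<beta> * real n) / Gamma (\<beta> * real n + 1) * v s)"
  shows kernel_integral_bound: "\<bar>I n\<bar> \<le> (\<bar>c\<bar> * L powr \<beta>) ^ n / Gamma (\<beta> * real n + 1) *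
      integral\<^sup>L (lebesgue_on {a<..<t}) (\<lambda>s. \<bar>v s\<bar>)" (is "?bound n")
    and kernel_integral_sums: "I sums integral\<^sup>L (lebesgue_on {a<..<t})
      (\<lambda>s. (\<Sum>n. (c * (t - s) powr \<beta>) ^ n / Gamma (\<beta> * real n + 1)) * v s)"
proof -
  let ?M = "lebesgue_on {a<..<t}"
  define K where "K = (\<lambda>n s. c ^ n * (t - s) powr (\<beta> * real n) / Gamma (\<beta> * real n + 1))"
  define A where "A = (\<lambda>n. (\<bar>c\<bar> * L powr \<beta>) ^ n / Gamma (\<beta> * real n + 1))"
  have A: "summable A" unfolding A_def by (rule summable_power_over_Gamma[OF \<beta>])
  have KA: "\<bar>K n s\<bar> \<le> A n" if "s \<in> {a<..<t}" for n s
    unfolding K_def A_def using that L \<beta> by (intro kernel_term_bound) auto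
  have Kpow: "K n s = (c * (t - s) powr \<beta>) ^ n / Gamma (\<beta> * real n + 1)" if "s \<in> {a<..<t}" for n s
    using that by (simp add: K_def power_mult_distrib powr_powr[symmetric] powr_realpow)
  have Kint: "integrable ?M (\<lambda>s. K n s * v s)" for n
  proof (rule Bochner_Integration.integrable_bound)
    show "integrable ?M (\<lambda>s. A n * v s)" using v by simp
    have "continuous_on {a<..<t} (K n)"
      unfolding K_def using Gamma_mult_nat_add_1_pos[OF \<beta>, of n]
      by (intro continuous_intros) auto
    then have "K n \<in> borel_measurable ?M"
      by (rule continuous_imp_measurable_on_sets_lebesgue) auto
    then show "(\<lambda>s. K n s * v s) \<in> borel_measurable ?M"
      using v by auto
    show "AE s in ?M. norm (K n s * v s) \<le> norm (A n * v s)"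
      using KA[of _ n] by (intro AE_I2) (force simp: abs_mult intro!: mult_right_mono)
  qed
  have norm_le: "integral\<^sup>L ?M (\<lambda>s. norm (K n s * v s)) \<le> A n * integral\<^sup>L ?M (\<lambda>s. \<bar>v s\<bar>)" for n
    unfolding Bochner_Integration.integral_mult_right_zero[symmetric]
    using KA[of _ n] v
    by (intro integral_mono integrable_norm Kint) (auto simp: abs_mult intro!: mult_right_mono)
  have I: "I n = integral\<^sup>L ?M (\<lambda>s. K n s * v s)" for n
    by (simp add: I_def K_def)
  show "?bound n"
    using order_trans[OF integral_norm_bound norm_le[of n]]
    by (simp add: I A_def)
  have "(\<lambda>n. integral\<^sup>L ?M (\<lambda>s. K n s * v s)) sums integral\<^sup>L ?M (\<lambda>s. \<Sum>n. K n s * v s)"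
  proof (rule sums_integral)
    show "AE s in ?M. summable (\<lambda>n. norm (K n s * v s))"
    proof (rule AE_I2)
      fix s assume "s \<in> space ?M"
      then have "norm (norm (K n s * v s)) \<le> A n * \<bar>v s\<bar>" for n
        using KA[of s n] by (auto simp: abs_mult intro!: mult_right_mono)
      then show "summable (\<lambda>n. norm (K n s * v s))"
        by (intro summable_comparison_test[OF _ summable_mult2[OF A, of "\<bar>v s\<bar>"]]) blast
    qed
    show "summable (\<lambda>n. integral\<^sup>L ?M (\<lambda>s. norm (K n s * v s)))"
      using norm_le
      by (intro summable_comparison_test[OF _ summable_mult2[OF A, of "integral\<^sup>L ?M (\<lambda>s. \<bar>v s\<bar>)"]])
         auto
  qed (rule Kint)
  moreover have "integral\<^sup>L ?M (\<lambda>s. \<Sum>n. K n s * v s) =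
      integral\<^sup>L ?M (\<lambda>s. (\<Sum>n. (c * (t - s) powr \<beta>) ^ n / Gamma (\<beta> * real n + 1)) * v s)"
    using summable_power_over_Gamma[OF \<beta>]
    by (intro Bochner_Integration.integral_cong) (auto simp: Kpow suminf_mult2)
  ultimately show "I sums integral\<^sup>L ?M
      (\<lambda>s. (\<Sum>n. (c * (t - s) powr \<beta>) ^ n / Gamma (\<beta> * real n + 1)) * v s)"
    using I by (metis (no_types, lifting) sums_cong)
qed

theorem lemma3:
  fixes a b \<alpha> \<beta> p :: real and N \<omega> g :: "real \<Rightarrow> real"
  assumes "a < b"
    and "0 \<le> \<alpha>" and "\<alpha> < 1"
    and "\<beta> > 0" and "p > 0"
    and "normalization N"
    and "C1_on a b \<omega>" and "\<forall>t\<in>{a..b}. \<omega> t > 0"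
    and "g \<in> H1 a b"
  defines "T \<equiv> \<lambda>n t. (- mu \<alpha> * ln p) ^ n *
      weighted_RL_integral a \<omega> (\<beta> * real n + 1) (\<lambda>s. weak_deriv a b (\<lambda>r. \<omega> r * g r) s / \<omega> s) t"
  shows "(\<forall>t\<in>{a..b}. power_caputo_deriv N a b \<omega> \<alpha> \<beta> p g t = 1 / phi N \<alpha> * (\<Sum>n. T n t)) \<and>
    uniform_limit {a..b} (\<lambda>m t. \<Sum>n<m. T n t) (\<lambda>t. \<Sum>n. T n t) sequentially"
proof -
  define v where "v = weak_deriv a b (\<lambda>r. \<omega> r * g r)"
  define c where "c = - mu \<alpha> * ln p"
  define I where "I = (\<lambda>t n. integral\<^sup>L (lebesgue_on {a<..<t})
    (\<lambda>s. c ^ n * (t - s) powr (\<beta> * real n) / Gamma (\<beta> * real n + 1) * v s))"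
  have v: "integrable (lebesgue_on {a<..<b}) v"
    unfolding v_def by (intro L2_imp_integrable weak_deriv_L2 H1_mult_C1 assms)
  have vt: "integrable (lebesgue_on {a<..<t}) v" if "t \<in> {a..b}" for t
    using that by (intro integrable_lebesgue_on_Ioo_mono[OF v]) auto
  have T: "T n t = 1 / \<omega> t * I t n" if t: "t \<in> {a..b}" for n t
  proof -
    have "T n t = c ^ n * (1 / Gamma (\<beta> * real n + 1) * (1 / \<omega> t) *
        integral\<^sup>L (lebesgue_on {a<..<t}) (\<lambda>s. (t - s) powr (\<beta> * real n) * (\<omega> s * (v s / \<omega> s))))"
      by (simp add: T_def weighted_RL_integral_def set_integral_Icc_eq_Ioo v_def c_def)
    also have "integral\<^sup>L (lebesgue_on {a<..<t}) (\<lambda>s. (t - s) powr (\<beta> * real n) * (\<omega> s * (v s / \<omega> s))) =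
        integral\<^sup>L (lebesgue_on {a<..<t}) (\<lambda>s. (t - s) powr (\<beta> * real n) * v s)"
    proof (intro Bochner_Integration.integral_cong refl)
      fix s assume "s \<in> space (lebesgue_on {a<..<t})"
      then have "\<omega> s > 0"
        using t assms(8) by auto
      then show "(t - s) powr (\<beta> * real n) * (\<omega> s * (v s / \<omega> s)) = (t - s) powr (\<beta> * real n) * v s"
        by simp
    qed
    also have "c ^ n * (1 / Gamma (\<beta> * real n + 1) * (1 / \<omega> t) * \<dots>) = 1 / \<omega> t * I t n"
    proof -
      have "I t n = integral\<^sup>L (lebesgue_on {a<..<t})
          (\<lambda>s. (c ^ n / Gamma (\<beta> * real n + 1)) * ((t - s) powr (\<beta> * real n) * v s))"
        unfolding I_def by (intro Bochner_Integration.integral_cong) auto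
      then show ?thesis by simp
    qed
    finally show ?thesis .
  qed
  have "power_caputo_deriv N a b \<omega> \<alpha> \<beta> p g t = 1 / phi N \<alpha> * (\<Sum>n. T n t)" if t: "t \<in> {a..b}" for t
  proof -
    have "I t sums integral\<^sup>L (lebesgue_on {a<..<t})
        (\<lambda>s. (\<Sum>n. (c * (t - s) powr \<beta>) ^ n / Gamma (\<beta> * real n + 1)) * v s)"
      unfolding I_def by (rule kernel_integral_sums[OF \<open>\<beta> > 0\<close> order_refl vt[OF t]])
    then have "(\<lambda>n. T n t) sums (1 / \<omega> t * integral\<^sup>L (lebesgue_on {a<..<t})
        (\<lambda>s. (\<Sum>n. (c * (t - s) powr \<beta>) ^ n / Gamma (\<beta> * real n + 1)) * v s))"
      unfolding T[OF t] by (rule sums_mult)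
    moreover have "(\<lambda>s. power_mittag_leffler p \<beta> 1 (- mu \<alpha> * (t - s) powr \<beta>) * v s) =
        (\<lambda>s. (\<Sum>n. (c * (t - s) powr \<beta>) ^ n / Gamma (\<beta> * real n + 1)) * v s)"
      by (simp add: power_mittag_leffler_def c_def mult_ac)
    ultimately show ?thesis
      by (simp add: power_caputo_deriv_def set_integral_Icc_eq_Ioo v_def sums_unique[symmetric]
          mult.assoc)
  qed
  moreover have "uniform_limit {a..b} (\<lambda>m t. \<Sum>n<m. T n t) (\<lambda>t. \<Sum>n. T n t) sequentially"
  proof -
    have "continuous_on {a..b} \<omega>"
      using assms(7) by (auto simp: C1_on_def intro: DERIV_continuous_on)
    then have "continuous_on {a..b} (\<lambda>t. 1 / \<omega> t)"
      using assms(8) by (intro continuous_intros) force+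
    then obtain W where W: "W \<ge> 0" "\<And>t. t \<in> {a..b} \<Longrightarrow> \<bar>1 / \<omega> t\<bar> \<le> W"
      using continuous_on_Icc_bounded by metis
    define V where "V = integral\<^sup>L (lebesgue_on {a<..<b}) (\<lambda>s. \<bar>v s\<bar>)"
    let ?A = "\<lambda>n. (\<bar>c\<bar> * (b - a) powr \<beta>) ^ n / Gamma (\<beta> * real n + 1)"
    show ?thesis
    proof (rule Weierstrass_m_test)
      show "summable (\<lambda>n. W * (?A n * V))"
        by (intro summable_mult summable_mult2 summable_power_over_Gamma \<open>\<beta> > 0\<close>)
      fix n t assume t: "t \<in> {a..b}"
      have A: "?A n \<ge> 0"
        using Gamma_mult_nat_add_1_pos[OF \<open>\<beta> > 0\<close>, of n] by simp
      have "\<bar>I t n\<bar> \<le> ?A n * integral\<^sup>L (lebesgue_on {a<..<t}) (\<lambda>s. \<bar>v s\<bar>)"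
        unfolding I_def using t by (intro kernel_integral_bound \<open>\<beta> > 0\<close> vt) auto
      also have "\<dots> \<le> ?A n * V"
        unfolding V_def using t by (intro mult_left_mono A integral_abs_lebesgue_on_Ioo_mono v) auto
      finally have "\<bar>I t n\<bar> \<le> ?A n * V" .
      then show "norm (T n t) \<le> W * (?A n * V)"
        unfolding T[OF t] real_norm_def abs_mult[of "1 / \<omega> t"]
        using W t by (intro mult_mono) auto
    qed
  qed
  ultimately show ?thesis by blast
qed

end
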